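(* For every $c\in\left(\frac13,\frac12\right)$ and positive integer $n$, we have \[g(n;3,t+1)\ge e(\Gamma(n;k,t))-O(n),\] where $t=\lceil cn\rceil$ and $k$ is the unique integer such that $kn/(3k-1)\le t<(k-1)n/(3k-4)$ (the implied constant depending only on $c$).
   Context: A red/blue/purple colouring of $K_n$ is a partition $R\cup B\cup P$ of its edge set. For integers $s,t\ge2$ and $n<R(s,t)$, $g(n;s,t)$ is the largest integer $g$ such that some red/blue/purple colouring of $K_n$ has $|P|=g$, $R\cup P$ is $K_s$-free and $B\cup P$ is $K_t$-free. For $k\ge2$, the Andrásfai graph $\Gamma_k$ has vertex set $\mathbb{Z}/(3k-1)\mathbb{Z}$, with $i,j$ adjacent iff $i-j\in\{k,\dots,2k-1\}$. For integers $n,t$ with $kn/(3k-1)\le t<(k-1)n/(3k-4)$, the canonical blow-up $\Gamma(n;k,t)$ is obtained from $\Gamma_k$ by replacing each of the vertices $1,k,2k$ by an independent set of $(k-1)n-(3k-4)t$ vertices, each of the other $3k-4$ vertices by an independent set of $3t-n$ vertices, and each edge by a complete bipartite graph between the corresponding sets; $e(\cdot)$ denotes number of edges. *)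

theory Defs
  imports Complex_Main "HOL-Library.Ramsey"
begin

text \<open>Graphs are given by their edge sets, consisting of two-element sets of vertices.
  The complete graph on \<open>n\<close> vertices has vertex set \<open>{..<n}\<close>.\<close>

definition rbp_colouring :: "nat \<Rightarrow> nat set set \<Rightarrow> nat set set \<Rightarrow> nat set set \<Rightarrow> bool" where
  "rbp_colouring n R B P \<longleftrightarrow>
     R \<union> B \<union> P = [{..<n}]\<^bsup>2\<^esup> \<and> R \<inter> B = {} \<and> R \<inter> P = {} \<and> B \<inter> P = {}"

definition clique_free :: "nat \<Rightarrow> 'a set \<Rightarrow> 'a set set \<Rightarrow> bool" where
  "clique_free s V E \<longleftrightarrow> \<not> (\<exists>K\<subseteq>V. finite K \<and> card K = s \<and> clique K E)"

text \<open>The maximum is over a finite set, which is nonempty exactly when \<open>n\<close> is less than the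
  Ramsey number of \<open>s\<close> and \<open>t\<close>; for other arguments the value is unspecified.\<close>

definition max_purple :: "nat \<Rightarrow> nat \<Rightarrow> nat \<Rightarrow> nat" where
  "max_purple n s t = Max {card P | R B P. rbp_colouring n R B P \<and>
     clique_free s {..<n} (R \<union> P) \<and> clique_free t {..<n} (B \<union> P)}"

text \<open>Residues modulo \<open>3 k - 1\<close> are represented by the integers in \<open>{0..<3 k - 1}\<close>.\<close>

definition andrasfai_verts :: "nat \<Rightarrow> int set" where
  "andrasfai_verts k = {0..<3 * int k - 1}"

definition andrasfai_edges :: "nat \<Rightarrow> int set set" where
  "andrasfai_edges k = {{i, j} | i j. i \<in> andrasfai_verts k \<and> j \<in> andrasfai_verts k \<and>
     (i - j) mod (3 * int k - 1) \<in> {int k..2 * int k - 1}}"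

text \<open>In a blow-up, the vertex \<open>v\<close> is replaced by the independent set \<open>{v} \<times> {..<w v}\<close>.\<close>

definition blowup_edges :: "'a set set \<Rightarrow> ('a \<Rightarrow> nat) \<Rightarrow> ('a \<times> nat) set set" where
  "blowup_edges E w = {{(u, a), (v, b)} | u v a b. {u, v} \<in> E \<and> a < w u \<and> b < w v}"

text \<open>Both arguments of \<open>nat\<close> are positive when
  \<open>k n / (3 k - 1) \<le> t < (k - 1) n / (3 k - 4)\<close> and \<open>k \<ge> 2\<close>, so nothing is truncated.\<close>

definition canonical_weight :: "nat \<Rightarrow> nat \<Rightarrow> nat \<Rightarrow> int \<Rightarrow> nat" where
  "canonical_weight n k t v =
     (if v \<in> {1, int k, 2 * int k}
      then nat ((int k - 1) * int n - (3 * int k - 4) * int t)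
      else nat (3 * int t - int n))"

definition canonical_blowup_edges :: "nat \<Rightarrow> nat \<Rightarrow> nat \<Rightarrow> (int \<times> nat) set set" where
  "canonical_blowup_edges n k t = blowup_edges (andrasfai_edges k) (canonical_weight n k t)"

definition canonical_index :: "nat \<Rightarrow> nat \<Rightarrow> nat \<Rightarrow> bool" where
  "canonical_index n t k \<longleftrightarrow> k \<ge> 2 \<and>
     real k * real n / (3 * real k - 1) \<le> real t \<and>
     real t < (real k - 1) * real n / (3 * real k - 4)"

lemma canonical_index_iff:
  assumes "n < 3 * t" "2 * t < n"
  shows "canonical_index n t k \<longleftrightarrow> int k = \<lceil>real t / (3 * real t - real n)\<rceil>"
proof -
  define d where "d = 3 * real t - real n"
  have d: "d > 0" "d < real t" using assms unfolding d_def by linarith+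
  have A: "real k * real n / (3 * real k - 1) \<le> real t \<longleftrightarrow> real t / d \<le> real k" if "k \<ge> 2"
  proof -
    have "3 * real k - 1 > 0" using that by linarith
    then have "real k * real n / (3 * real k - 1) \<le> real t \<longleftrightarrow>
        real k * real n \<le> real t * (3 * real k - 1)"
      by (rule pos_divide_le_eq)
    also have "\<dots> \<longleftrightarrow> real t \<le> real k * d"
      by (simp add: d_def algebra_simps)
    also have "\<dots> \<longleftrightarrow> real t / d \<le> real k"
      using pos_divide_le_eq[OF d(1)] by blast
    finally show ?thesis .
  qed
  have B: "real t < (real k - 1) * real n / (3 * real k - 4) \<longleftrightarrow> real k - 1 < real t / d"
    if "k \<ge> 2"
  proof -
    have "3 * real k - 4 > 0" using that by linarith
    then have "real t < (real k - 1) * real n / (3 * real k - 4) \<longleftrightarrow>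
        real t * (3 * real k - 4) < (real k - 1) * real n"
      by (rule pos_less_divide_eq)
    also have "\<dots> \<longleftrightarrow> (real k - 1) * d < real t"
      by (auto simp add: d_def algebra_simps)
    also have "\<dots> \<longleftrightarrow> real k - 1 < real t / d"
      using pos_less_divide_eq[OF d(1)] by blast
    finally show ?thesis .
  qed
  have C: "k \<ge> 2" if "real t / d \<le> real k"
  proof -
    have "1 < real t / d" using d by simp
    with that have "1 < real k" by linarith
    then show ?thesis by linarith
  qed
  have "canonical_index n t k \<longleftrightarrow> real k - 1 < real t / d \<and> real t / d \<le> real k"
    unfolding canonical_index_def using A B C by blast
  also have "\<dots> \<longleftrightarrow> int k = \<lceil>real t / d\<rceil>"
    by linarith
  finally show ?thesis by (simp add: d_def)
qed

text \<open>If \<open>t = \<lceil>c n\<rceil>\<close> with \<open>1/3 < c < 1/2\<close>, the hypotheses hold for all sufficiently large \<open>n\<close>;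
  for the finitely many \<open>n\<close> with \<open>2 t \<ge> n\<close> there is no admissible \<open>k\<close>.\<close>

lemma canonical_index_unique:
  assumes "n < 3 * t" "2 * t < n"
  shows "\<exists>!k. canonical_index n t k"
proof -
  have "3 * real t - real n > 0" using assms by linarith
  then have "real t / (3 * real t - real n) \<ge> 0" by simp
  then have "\<lceil>real t / (3 * real t - real n)\<rceil> \<ge> 0" by linarith
  then show ?thesis
    unfolding canonical_index_iff[OF assms] by (metis nat_0_le nat_int)
qed

lemma canonical_index_imp:
  assumes "canonical_index n t k"
  shows "2 * t < n"
proof -
  have k: "3 * real k - 4 > 0" "k \<ge> 2" using assms by (auto simp: canonical_index_def)
  have "real t < (real k - 1) * real n / (3 * real k - 4)"
    using assms by (simp add: canonical_index_def)
  also have "\<dots> \<le> real n / 2"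
  proof -
    have "(real k - 2) * real n \<ge> 0" using k by simp
    then have "2 * ((real k - 1) * real n) \<le> real n * (3 * real k - 4)"
      by (simp add: algebra_simps)
    then show ?thesis using k(1) by (simp add: pos_divide_le_eq)
  qed
  finally show ?thesis by linarith
qed

end

theory Submission
  imports Defs "HOL-Library.FuncSet"
begin

text \<open>Let the red and purple edges together form the canonical blow-up, which is triangle-free. It
  then suffices to choose \<open>O(n)\<close> red edges such that every set of \<open>t + 1\<close> vertices contains one of
  them. Between any two adjacent classes the red edges form a random bipartite graph of constant
  degree, an expander; the constants are uniform because, for fixed \<open>c\<close>, only finitely many \<open>k\<close>
  occur and all classes have size linear in \<open>n\<close>. A set without red edges is then at most as large
  as a union of classes over an independent set of the Andrasfai graph, hence has at most \<open>t\<close>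
  vertices.\<close>

section \<open>Expanding maps\<close>

text \<open>The obstacle is that the bound \<open>t\<close> must be exact: a set that fills most of
  an independent union of classes and has a few stray vertices elsewhere must contain a red edge as
  soon as its size is \<open>t + 1\<close>. Two kinds of expansion, separated by a threshold
  \<open>p\<close>, achieve this. The neighbours of at least \<open>p\<close> vertices of one class
  miss at most \<open>p\<close> vertices of an adjacent class, so classes with many chosen vertices
  are pairwise non-adjacent. At most \<open>p\<close> vertices expand by a factor \<open>D\<close>,
  no smaller than the number of classes, so stray vertices cost enough to pay for all classes
  charged to the same place. Constant degree suffices while \<open>p\<close> is a fixed proportion
  of \<open>n\<close> and every class is a large multiple of it. The light classes could shrink to
  nothing as \<open>t\<close> approaches its upper limit. For fixed \<open>c\<close> they do not:
  since \<open>t\<close> is rounded up, the strict upper bound on \<open>t\<close> passes to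
  \<open>c * n\<close>, and the finitely many \<open>k\<close> leave a positive minimum.\<close>

lemma binomial_le_exp_power:
  assumes "s > 0"
  shows "real (n choose s) \<le> (exp 1 * real n / real s) ^ s"
proof -
  have "real s ^ s / fact s \<le> exp (real s)"
  proof -
    have "(\<Sum>i\<in>{s}. real s ^ i /\<^sub>R fact i) \<le> (\<Sum>i. real s ^ i /\<^sub>R fact i)"
      by (intro sum_le_suminf summable_exp_generic) auto
    then show ?thesis by (simp add: exp_def field_simps)
  qed
  also have "exp (real s) = exp 1 ^ s"
    by (simp add: exp_of_nat_mult [symmetric])
  finally have 1: "real s ^ s \<le> exp 1 ^ s * fact s" by (simp add: field_simps)
  have "(n choose s) * fact s \<le> n ^ s"
    by (rule binomial_fact_pow)
  then have 2: "real (n choose s) * fact s \<le> real n ^ s"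
    by (metis of_nat_fact of_nat_le_iff of_nat_mult of_nat_power)
  have "real (n choose s) * real s ^ s \<le> real (n choose s) * (exp 1 ^ s * fact s)"
    by (intro mult_left_mono 1) auto
  also have "\<dots> \<le> exp 1 ^ s * real n ^ s"
    using mult_left_mono[OF 2, of "exp 1 ^ s"] by (simp add: mult_ac)
  finally show ?thesis using assms
    by (simp add: power_divide power_mult_distrib field_simps)
qed

text \<open>Union bound by counting: \<open>small\<close> adds up the proportions of maps that are
  bad for each pair, so a total below \<open>1\<close> leaves a map that is bad for none. The
  \<open>d\<close> values at a vertex are chosen independently and may repeat, which makes these
  proportions exact powers.\<close>

lemma exists_map_avoiding:
  fixes \<F> :: "('a set \<times> 'b set) set"
  assumes fin: "finite A" "finite B" "finite \<F>" and ne: "B \<noteq> {}"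
    and sub: "\<And>X Y. (X, Y) \<in> \<F> \<Longrightarrow> X \<subseteq> A \<and> Y \<subseteq> B"
    and small: "(\<Sum>(X, Y)\<in>\<F>. (real (card Y) / real (card B)) ^ (d * card X)) < 1"
  obtains f :: "'a \<times> nat \<Rightarrow> 'b" where "f \<in> A \<times> {..<d} \<rightarrow>\<^sub>E B"
    "\<And>X Y. (X, Y) \<in> \<F> \<Longrightarrow> \<not> f ` (X \<times> {..<d}) \<subseteq> Y"
proof -
  define \<Omega> where "\<Omega> = (A \<times> {..<d} \<rightarrow>\<^sub>E B)"
  \<comment> \<open>Restricting the codomain to \<open>Y\<close> only over
    \<open>X \<times> {..<d}\<close> keeps the bad maps a product space, whose cardinality is a
    product.\<close>
  define bad where "bad = (\<lambda>(X, Y). PiE (A \<times> {..<d}) (\<lambda>z. if z \<in> X \<times> {..<d} then Y else B))"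
  have B0: "card B > 0" using fin ne by (simp add: card_gt_0_iff)
  have card\<Omega>: "card \<Omega> = card B ^ (d * card A)"
    unfolding \<Omega>_def using fin by (simp add: card_PiE mult.commute)
  have card_bad: "real (card (bad (X, Y))) =
      (real (card Y) / real (card B)) ^ (d * card X) * real (card \<Omega>)" if "(X, Y) \<in> \<F>" for X Y
  proof -
    have X: "X \<subseteq> A" "finite X" using sub[OF that] fin finite_subset by auto
    have "card (bad (X, Y)) =
        (\<Prod>z\<in>A \<times> {..<d}. if z \<in> X \<times> {..<d} then card Y else card B)"
      unfolding bad_def using fin by (auto simp: card_PiE intro!: prod.cong)
    also have "\<dots> = (\<Prod>z\<in>X \<times> {..<d}. card Y) * (\<Prod>z\<in>(A - X) \<times> {..<d}. card B)"
    proof -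
      have split: "A \<times> {..<d} = X \<times> {..<d} \<union> (A - X) \<times> {..<d}" using X by auto
      have "(\<Prod>z\<in>(A - X) \<times> {..<d}. if z \<in> X \<times> {..<d} then card Y else card B) =
          (\<Prod>z\<in>(A - X) \<times> {..<d}. card B)" by (rule prod.cong) auto
      moreover have "(\<Prod>z\<in>X \<times> {..<d}. if z \<in> X \<times> {..<d} then card Y else card B) =
          (\<Prod>z\<in>X \<times> {..<d}. card Y)" by (rule prod.cong) auto
      ultimately show ?thesis
        unfolding split using X fin by (subst prod.union_disjoint) auto
    qed
    also have "\<dots> = card Y ^ (d * card X) * card B ^ (d * (card A - card X))"
      using X fin by (simp add: card_Diff_subset mult.commute)
    finally have *: "card (bad (X, Y)) = card Y ^ (d * card X) * card B ^ (d * (card A - card X))" .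
    have "d * card A = d * card X + d * (card A - card X)"
      using card_mono[OF fin(1) X(1)] by (simp add: diff_mult_distrib2)
    then show ?thesis unfolding card\<Omega> * using B0
      by (simp add: power_add power_divide)
  qed
  have "card (\<Union>(bad ` \<F>)) \<le> (\<Sum>z\<in>\<F>. card (bad z))"
    by (rule card_UN_le[OF fin(3)])
  then have "real (card (\<Union>(bad ` \<F>))) \<le> (\<Sum>z\<in>\<F>. real (card (bad z)))"
    by (metis of_nat_le_iff of_nat_sum)
  also have "\<dots> = (\<Sum>(X, Y)\<in>\<F>. (real (card Y) / real (card B)) ^ (d * card X)) * real (card \<Omega>)"
    unfolding sum_distrib_right by (rule sum.cong) (auto simp: card_bad)
  also have "\<dots> < 1 * real (card \<Omega>)"
    using small by (rule mult_strict_right_mono) (use B0 card\<Omega> in simp)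
  finally have lt: "card (\<Union>(bad ` \<F>)) < card \<Omega>" by simp
  have "finite (\<Union>(bad ` \<F>))"
  proof (rule finite_UN_I[OF fin(3)])
    fix z assume "z \<in> \<F>"
    then obtain X Y where "z = (X, Y)" "finite Y"
      using sub fin by (metis finite_subset surj_pair)
    then show "finite (bad z)" using fin by (auto simp: bad_def intro!: finite_PiE)
  qed
  then have "\<not> \<Omega> \<subseteq> \<Union>(bad ` \<F>)" using lt card_mono leD by blast
  then obtain f where f: "f \<in> \<Omega>" "\<And>z. z \<in> \<F> \<Longrightarrow> f \<notin> bad z" by blast
  show thesis
  proof (rule that)
    show "f \<in> A \<times> {..<d} \<rightarrow>\<^sub>E B" using f(1) by (simp add: \<Omega>_def)
    fix X Y assume XY: "(X, Y) \<in> \<F>"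
    show "\<not> f ` (X \<times> {..<d}) \<subseteq> Y"
    proof
      assume "f ` (X \<times> {..<d}) \<subseteq> Y"
      then have "f \<in> bad (X, Y)" using f(1)
        by (force simp: bad_def \<Omega>_def PiE_iff)
      then show False using f(2)[OF XY] by simp
    qed
  qed
qed

text \<open>The pairs \<open>(x, i)\<close> with \<open>i < d\<close> encode the \<open>d\<close> neighbours \<open>f (x, i)\<close> of \<open>x\<close>.\<close>

definition expanding_map :: "nat \<Rightarrow> nat \<Rightarrow> nat \<Rightarrow> nat \<Rightarrow> nat \<Rightarrow> (nat \<times> nat \<Rightarrow> nat) \<Rightarrow> bool" where
  "expanding_map D p d a b f \<longleftrightarrow> f \<in> {..<a} \<times> {..<d} \<rightarrow> {..<b} \<and>
     (\<forall>X\<subseteq>{..<a}. (card X \<le> p \<longrightarrow> D * card X \<le> card (f ` (X \<times> {..<d}))) \<and>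
       (p \<le> card X \<longrightarrow> b \<le> card (f ` (X \<times> {..<d})) + p))"

text \<open>A random map sends \<open>X \<times> {..<d}\<close> into \<open>Y\<close> with probability \<open>(card Y / b) ^ (d * card X)\<close>;
  the union bound over all offending pairs is below \<open>1\<close> once \<open>d\<close> is large.\<close>

lemma expanding_map_exists:
  fixes D L :: nat
  obtains d where "\<And>a b p. 0 < p \<Longrightarrow> a \<le> L * p \<Longrightarrow> b \<le> L * p \<Longrightarrow> 2 * D * p \<le> b \<Longrightarrow> p \<le> b \<Longrightarrow>
    \<exists>f. expanding_map D p d a b f"
proof (cases "L = 0")
  case True
  \<comment> \<open>With \<open>L = 0\<close>, the hypotheses \<open>0 < p\<close>,
    \<open>p \<le> b\<close> and \<open>b \<le> L * p\<close> are contradictory.\<close>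
  then show ?thesis by (intro that[of 0]) auto
next
  case False
  define Z where "Z = exp 1 ^ D * (exp 1 * real L / 2)"
  have Z: "Z > 0" using False by (simp add: Z_def)
  have "(\<lambda>m. Z * (1/2) ^ m) \<longlonglongrightarrow> Z * 0"
    by (intro tendsto_intros LIMSEQ_realpow_zero) auto
  then have "\<forall>\<^sub>F m in sequentially. Z * (1/2) ^ m < 1/4"
    by (rule order_tendstoD) auto
  then obtain m where m: "Z * (1/2) ^ m < 1/4"
    using eventually_happens by fastforce
  have "(\<lambda>d. 4 ^ L * (1 - 1 / real L) ^ d) \<longlonglongrightarrow> 4 ^ L * 0"
    using False by (intro tendsto_intros LIMSEQ_realpow_zero) auto
  then have "\<forall>\<^sub>F d in sequentially. 4 ^ L * (1 - 1 / real L) ^ d < 1/4"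
    by (rule order_tendstoD) auto
  then obtain d0 where d0: "\<And>d. d \<ge> d0 \<Longrightarrow> 4 ^ L * (1 - 1 / real L) ^ d < 1/4"
    by (auto simp: eventually_sequentially)
  \<comment> \<open>The share \<open>1\<close> of the exponent pays for the choice of
    \<open>X\<close>, the share \<open>D\<close> for the choice of \<open>Y\<close>, and
    \<open>m\<close> makes the terms for small sets decay geometrically; \<open>d0\<close> serves
    the large sets.\<close>
  define d where "d = m + D + 1 + d0"
  show ?thesis
  proof (rule that[of d])
    fix a b p :: nat
    assume p: "0 < p" and a: "a \<le> L * p" and b: "b \<le> L * p" and Dp: "2 * D * p \<le> b" and pb: "p \<le> b"
    define sub where "sub = (\<lambda>(n :: nat) s. {X. X \<subseteq> {..<n} \<and> card X = s})"
    have fin_sub: "finite (sub n s)" and card_sub: "card (sub n s) = n choose s" for n s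
      using n_subsets[of "{..<n}" s] by (auto simp: sub_def)
    \<comment> \<open>Only exact sizes are listed: an image that is too small can be enlarged to
      such a \<open>Y\<close>, and a large \<open>X\<close> contains a subset of size
      \<open>p\<close>.\<close>
    define F1 where "F1 = (\<lambda>s. sub a s \<times> sub b (D * s))"
    define F2 where "F2 = sub a p \<times> sub b (b - p)"
    define \<F> where "\<F> = (\<Union>s\<in>{1..p}. F1 s) \<union> F2"
    define h where "h = (\<lambda>(X :: nat set, Y :: nat set).
        (real (card Y) / real (card {..<b})) ^ (d * card X))"
    have fin: "finite (F1 s)" "finite F2" for s by (auto simp: F1_def F2_def fin_sub)
    have sum1: "sum h (F1 s) \<le> (1/4) ^ s" if s: "s \<in> {1..p}" for s
    proof -
      \<comment> \<open>The density of \<open>Y\<close> in the target;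
        \<open>2 * D * p \<le> b\<close> keeps it at most \<open>1/2\<close>.\<close>
      define \<rho> where "\<rho> = real (D * s) / real b"
      have b0: "b > 0" using pb p by simp
      have "2 * D * s \<le> b" using s Dp by (meson atLeastAtMost_iff le_trans mult_le_mono2)
      then have "2 * real (D * s) \<le> real b" by (metis mult.assoc of_nat_le_iff of_nat_mult of_nat_numeral)
      then have \<rho>: "0 \<le> \<rho>" "\<rho> \<le> 1/2" using b0 by (auto simp: \<rho>_def field_simps)
      have "sum h (F1 s) = (\<Sum>z\<in>F1 s. \<rho> ^ (d * s))"
        by (rule sum.cong) (auto simp: F1_def h_def sub_def \<rho>_def)
      also have "\<dots> = real (a choose s) * real (b choose (D * s)) * \<rho> ^ (d * s)"
        by (simp add: F1_def card_cartesian_product card_sub)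
      also have "\<dots> = (real (a choose s) * \<rho> ^ s) * (real (b choose (D * s)) * \<rho> ^ (D * s))
          * \<rho> ^ ((m + d0) * s)"
      proof -
        have "d * s = s + D * s + (m + d0) * s" by (simp add: d_def algebra_simps)
        then show ?thesis by (simp add: power_add mult_ac)
      qed
      also have "\<dots> \<le> (exp 1 * real L / 2) ^ s * (exp 1 ^ D) ^ s * ((1/2) ^ m) ^ s"
      proof (intro mult_mono)
        have "real (a choose s) * \<rho> ^ s \<le> (exp 1 * real a / real s) ^ s * \<rho> ^ s"
          using s \<rho> by (intro mult_right_mono binomial_le_exp_power) auto
        \<comment> \<open>The factor \<open>s\<close> in \<open>\<rho>\<close> cancels the
          denominator, so the base is bounded independently of \<open>s\<close>.\<close>
        also have "\<dots> = (exp 1 * (real a * real D / real b)) ^ s"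
          unfolding power_mult_distrib [symmetric] using s by (simp add: \<rho>_def)
        also have "\<dots> \<le> (exp 1 * (real L / 2)) ^ s"
        proof (intro power_mono mult_left_mono)
          have "2 * (a * D) \<le> 2 * (L * p * D)" using a by simp
          also have "\<dots> = L * (2 * D * p)" by (simp add: mult_ac)
          also have "\<dots> \<le> L * b" using Dp by simp
          finally have "2 * (real a * real D) \<le> real L * real b"
            by (metis of_nat_le_iff of_nat_mult of_nat_numeral)
          then show "real a * real D / real b \<le> real L / 2"
            using b0 by (simp add: field_simps)
        qed auto
        finally show "real (a choose s) * \<rho> ^ s \<le> (exp 1 * real L / 2) ^ s" by simp
        show "real (b choose (D * s)) * \<rho> ^ (D * s) \<le> (exp 1 ^ D) ^ s"
        proof (cases "D = 0")
          case False
          then have Ds: "D * s > 0" using s by simp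
          have "real (b choose (D * s)) * \<rho> ^ (D * s)
              \<le> (exp 1 * real b / real (D * s)) ^ (D * s) * \<rho> ^ (D * s)"
            using Ds \<rho> by (intro mult_right_mono binomial_le_exp_power) auto
          also have "\<dots> = (exp 1 * real b / real (D * s) * \<rho>) ^ (D * s)"
            by (simp only: power_mult_distrib)
          also have "exp 1 * real b / real (D * s) * \<rho> = exp 1"
            using Ds b0 by (simp add: \<rho>_def)
          finally show ?thesis by (simp add: power_mult)
        qed simp
        have "\<rho> ^ ((m + d0) * s) \<le> \<rho> ^ (m * s)"
          using \<rho> by (intro power_decreasing) auto
        also have "\<dots> \<le> (1/2) ^ (m * s)" using \<rho> by (intro power_mono) auto
        finally show "\<rho> ^ ((m + d0) * s) \<le> ((1/2) ^ m) ^ s" by (simp add: power_mult)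
      qed (use \<rho> in auto)
      also have "\<dots> = (Z * (1/2) ^ m) ^ s"
        unfolding Z_def power_mult_distrib [symmetric] by (simp add: mult_ac)
      also have "\<dots> \<le> (1/4) ^ s" using m Z by (intro power_mono) auto
      finally show ?thesis .
    qed
    have "sum h F2 \<le> 1/4"
    proof -
      have b0: "b > 0" using pb p by simp
      have "sum h F2 = (\<Sum>z\<in>F2. (real (b - p) / real b) ^ (d * p))"
        by (rule sum.cong) (auto simp: F2_def h_def sub_def)
      also have "\<dots> = real (a choose p) * real (b choose p) * (real (b - p) / real b) ^ (d * p)"
        using pb by (simp add: F2_def card_cartesian_product card_sub binomial_symmetric [symmetric])
      also have "\<dots> \<le> 2 ^ (L * p) * 2 ^ (L * p) * (1 - 1 / real L) ^ (d * p)"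
      proof (intro mult_mono)
        have *: "real (c choose p) \<le> 2 ^ (L * p)" if "c \<le> L * p" for c
        proof -
          have "(c choose p) \<le> 2 ^ c" by (rule binomial_le_pow2)
          also have "\<dots> \<le> 2 ^ (L * p)" using that by (intro power_increasing) auto
          finally show ?thesis by (metis of_nat_le_iff of_nat_numeral of_nat_power)
        qed
        show "real (a choose p) \<le> 2 ^ (L * p)" "real (b choose p) \<le> 2 ^ (L * p)"
          using * a b by auto
        have "real b \<le> real L * real p" using b by (metis of_nat_le_iff of_nat_mult)
        \<comment> \<open>As \<open>p\<close> is at least the fraction \<open>1 / L\<close> of the
          target, avoiding \<open>p\<close> points has probability bounded away from
          \<open>1\<close> in each trial.\<close>
        then have "real (b - p) / real b \<le> 1 - 1 / real L"
          using pb b0 False by (simp add: of_nat_diff field_simps)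
        then show "(real (b - p) / real b) ^ (d * p) \<le> (1 - 1 / real L) ^ (d * p)"
          by (intro power_mono) auto
      qed auto
      also have "\<dots> = (4 ^ L * (1 - 1 / real L) ^ d) ^ p"
        by (simp add: power_mult power_mult_distrib [symmetric])
      also have "\<dots> \<le> (1/4) ^ p"
        using d0[of d] False by (intro power_mono) (auto simp: d_def)
      also have "\<dots> \<le> (1/4) ^ 1" using p by (intro power_decreasing) auto
      finally show ?thesis by simp
    qed
    moreover have "sum h (\<Union>s\<in>{1..p}. F1 s) < 3/4"
    proof -
      have "sum h (\<Union>s\<in>{1..p}. F1 s) = (\<Sum>s\<in>{1..p}. sum h (F1 s))"
        by (rule sum.UNION_disjoint) (use fin in \<open>auto simp: F1_def sub_def\<close>)
      also have "\<dots> \<le> (\<Sum>s\<in>{1..p}. (1/4) ^ s)" by (rule sum_mono) (rule sum1)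
      also have "\<dots> = (1/4 - (1/4) ^ Suc p) / (3/4)"
        by (subst sum_gp) (use p in auto)
      also have "\<dots> < 3/4" by (simp add: field_simps add_pos_pos)
      finally show ?thesis .
    qed
    moreover have "sum h \<F> + sum h ((\<Union>s\<in>{1..p}. F1 s) \<inter> F2) = sum h (\<Union>s\<in>{1..p}. F1 s) + sum h F2"
      unfolding \<F>_def by (rule sum.union_inter) (use fin in auto)
    moreover have "sum h ((\<Union>s\<in>{1..p}. F1 s) \<inter> F2) \<ge> 0"
      by (rule sum_nonneg) (auto simp: h_def)
    ultimately have "sum h \<F> < 1" by linarith
    then have small: "(\<Sum>(X, Y)\<in>\<F>. (real (card Y) / real (card {..<b})) ^ (d * card X)) < 1"
      by (simp add: h_def)
    obtain f where f: "f \<in> {..<a} \<times> {..<d} \<rightarrow>\<^sub>E {..<b}"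
      and good: "\<And>X Y. (X, Y) \<in> \<F> \<Longrightarrow> \<not> f ` (X \<times> {..<d}) \<subseteq> Y"
    proof (rule exists_map_avoiding[OF _ _ _ _ _ small])
      show "finite \<F>" using fin by (simp add: \<F>_def)
      show "{..<b} \<noteq> {}" using pb p by (simp add: lessThan_empty_iff)
      show "X \<subseteq> {..<a} \<and> Y \<subseteq> {..<b}" if "(X, Y) \<in> \<F>" for X Y
        using that by (auto simp: \<F>_def F1_def F2_def sub_def)
    qed auto
    have img: "f ` (X \<times> {..<d}) \<subseteq> {..<b}" if "X \<subseteq> {..<a}" for X
      using f that by (fastforce simp: PiE_iff)
    have superset: "\<exists>Y. f ` (X \<times> {..<d}) \<subseteq> Y \<and> Y \<in> sub b s"
      if "X \<subseteq> {..<a}" "card (f ` (X \<times> {..<d})) \<le> s" "s \<le> b" for X s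
      using exists_subset_between[of "f ` (X \<times> {..<d})" s "{..<b}"] that img[OF that(1)]
      by (auto simp: sub_def)
    show "\<exists>f. expanding_map D p d a b f"
      unfolding expanding_map_def
    proof (intro exI[of _ f] conjI allI impI)
      show "f \<in> {..<a} \<times> {..<d} \<rightarrow> {..<b}" using f by (auto simp: PiE_iff)
      fix X assume X: "X \<subseteq> {..<a}"
      show "D * card X \<le> card (f ` (X \<times> {..<d}))" if "card X \<le> p"
      proof (rule ccontr)
        assume neg: "\<not> ?thesis"
        then have "card X \<in> {1..p}" using that by (cases "card X") auto
        have "D * card X \<le> b" using that Dp by (metis le_trans mult_le_mono2 le_add2 mult.assoc mult_2)
        then obtain Y where Y: "f ` (X \<times> {..<d}) \<subseteq> Y" "Y \<in> sub b (D * card X)"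
          using superset[OF X, of "D * card X"] neg by auto
        then have "(X, Y) \<in> F1 (card X)" using X by (auto simp: F1_def sub_def)
        then have "(X, Y) \<in> \<F>" using \<open>card X \<in> {1..p}\<close> unfolding \<F>_def by blast
        then show False using good Y by blast
      qed
      show "b \<le> card (f ` (X \<times> {..<d})) + p" if large: "p \<le> card X"
      proof (rule ccontr)
        assume neg: "\<not> ?thesis"
        obtain X' where X': "X' \<subseteq> X" "card X' = p"
          using large by (meson obtain_subset_with_card_n)
        have "finite X" using X finite_subset by auto
        then have "card (f ` (X' \<times> {..<d})) \<le> card (f ` (X \<times> {..<d}))"
          using X'(1) by (intro card_mono image_mono) auto
        then obtain Y where Y: "f ` (X' \<times> {..<d}) \<subseteq> Y" "Y \<in> sub b (b - p)"
          using superset[of X' "b - p"] neg X' X by fastforce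
        then have "(X', Y) \<in> \<F>" using X X' by (auto simp: \<F>_def F2_def sub_def)
        then show False using good Y by blast
      qed
    qed
  qed
qed

section \<open>Sparse subgraphs of blow-ups\<close>

text \<open>If \<open>I\<close> is independent in \<open>R\<close>, then the classes in which \<open>I\<close> has more than \<open>p\<close> vertices form an
  independent set of \<open>E\<close>. Extend it to a maximal one, \<open>J\<close>: every class outside \<open>J\<close> meets \<open>I\<close> in a
  small set \<open>X\<close>, whose neighbours exclude at least \<open>D * card X\<close> vertices of some class of \<open>J\<close>, so
  that \<open>I\<close> is no larger than the union of the classes of \<open>J\<close>.\<close>

lemma sparse_subgraph_of_blowup:
  fixes D L :: nat
  obtains d where "\<And>(V :: 'a set) E w p t. \<lbrakk>finite V; card V \<le> D; E \<subseteq> [V]\<^bsup>2\<^esup>; 0 < p;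
     \<And>v. v \<in> V \<Longrightarrow> 2 * D * p \<le> w v \<and> w v \<le> L * p;
     \<And>S. S \<subseteq> V \<Longrightarrow> (\<forall>e\<in>E. \<not> e \<subseteq> S) \<Longrightarrow> sum w S \<le> t\<rbrakk> \<Longrightarrow>
     \<exists>R\<subseteq>blowup_edges E w. card R \<le> d * sum w V \<and>
        clique_free (t + 1) (SIGMA v:V. {..<w v}) ([SIGMA v:V. {..<w v}]\<^bsup>2\<^esup> - R)"
proof -
  obtain d where d: "\<And>a b p. 0 < p \<Longrightarrow> a \<le> L * p \<Longrightarrow> b \<le> L * p \<Longrightarrow> 2 * D * p \<le> b \<Longrightarrow> p \<le> b \<Longrightarrow>
    \<exists>f. expanding_map D p d a b f"
    by (rule expanding_map_exists[of L D]) blast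
  show ?thesis
  proof (rule that[of "D * d"])
    fix V :: "'a set" and E w p t
    assume V: "finite V" "card V \<le> D" and E: "E \<subseteq> [V]\<^bsup>2\<^esup>" and p: "0 < p"
      and w: "\<And>v. v \<in> V \<Longrightarrow> 2 * D * p \<le> w v \<and> w v \<le> L * p"
      and ind: "\<And>S. S \<subseteq> V \<Longrightarrow> (\<forall>e\<in>E. \<not> e \<subseteq> S) \<Longrightarrow> sum w S \<le> t"
    have edge: "u \<in> V" "v \<in> V" "u \<noteq> v" if "{u, v} \<in> E" for u v
      using that E by (auto simp: nsets_def card_insert_if split: if_splits)
    have "\<exists>f. expanding_map D p d (w u) (w v) f" if uv: "u \<in> V" "v \<in> V" for u v
    proof -
      have "D \<ge> 1" using V uv by (metis One_nat_def Suc_leI card_gt_0_iff empty_iff le_trans)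
      then have "p \<le> 2 * D * p" by simp
      then have "p \<le> w v" using w uv le_trans by blast
      then show ?thesis using d p w uv by blast
    qed
    then obtain f where "\<And>u v. u \<in> V \<Longrightarrow> v \<in> V \<Longrightarrow> expanding_map D p d (w u) (w v) (f u v)"
      by metis
    then have f: "\<And>u v. u \<in> V \<Longrightarrow> v \<in> V \<Longrightarrow> f u v \<in> {..<w u} \<times> {..<d} \<rightarrow> {..<w v}"
      and f_small: "\<And>u v X. u \<in> V \<Longrightarrow> v \<in> V \<Longrightarrow> X \<subseteq> {..<w u} \<Longrightarrow> card X \<le> p \<Longrightarrow>
          D * card X \<le> card (f u v ` (X \<times> {..<d}))"
      and f_large: "\<And>u v X. u \<in> V \<Longrightarrow> v \<in> V \<Longrightarrow> X \<subseteq> {..<w u} \<Longrightarrow> p \<le> card X \<Longrightarrow>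
          w v \<le> card (f u v ` (X \<times> {..<d})) + p"
      unfolding expanding_map_def by blast+
    define W where "W = (SIGMA v:V. {..<w v})"
    \<comment> \<open>Since \<open>{u, v}\<close> is unordered, both \<open>f u v\<close> and
      \<open>f v u\<close> contribute edges, so expansion is available from either side.\<close>
    define R where "R = {{(u, x), (v, f u v (x, i))} | u v x i. {u, v} \<in> E \<and> x < w u \<and> i < d}"
    have "R \<subseteq> blowup_edges E w"
    proof
      fix e assume "e \<in> R"
      then obtain u v x i where *: "e = {(u, x), (v, f u v (x, i))}" "{u, v} \<in> E" "x < w u" "i < d"
        by (auto simp: R_def)
      then have "f u v (x, i) < w v" using f[OF edge(1,2)[OF *(2)]] by auto
      then show "e \<in> blowup_edges E w" using * by (auto simp: blowup_edges_def)
    qed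
    moreover have "card R \<le> D * d * sum w V"
    proof -
      define T where "T = W \<times> V \<times> {..<d}"
      have finT: "finite T" using V by (simp add: T_def W_def)
      have "R \<subseteq> (\<lambda>((u, x), v, i). {(u, x), (v, f u v (x, i))}) ` T"
      proof
        fix e assume "e \<in> R"
        then obtain u v x i where *: "e = {(u, x), (v, f u v (x, i))}" "{u, v} \<in> E" "x < w u" "i < d"
          by (auto simp: R_def)
        then have "((u, x), v, i) \<in> T" using edge by (auto simp: T_def W_def)
        then show "e \<in> (\<lambda>((u, x), v, i). {(u, x), (v, f u v (x, i))}) ` T"
          using *(1) by (intro image_eqI[of _ _ "((u, x), v, i)"]) auto
      qed
      then have "card R \<le> card T" using finT by (rule surj_card_le[rotated])
      also have "\<dots> = sum w V * (card V * d)" using V by (simp add: T_def W_def card_cartesian_product)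
      also have "\<dots> \<le> sum w V * (D * d)" using V by simp
      finally show ?thesis by (simp add: mult_ac)
    qed
    moreover have "clique_free (t + 1) W ([W]\<^bsup>2\<^esup> - R)"
      unfolding clique_free_def
    proof (rule notI, elim exE conjE)
      fix I assume I: "I \<subseteq> W" "finite I" "card I = t + 1" "clique I ([W]\<^bsup>2\<^esup> - R)"
      define X where "X = (\<lambda>v. {x. (v, x) \<in> I})"
      have X: "X v \<subseteq> {..<w v}" "finite (X v)" for v
        using I(1) finite_subset[of "X v" "{..<w v}"] by (auto simp: X_def W_def)
      have Xw: "card (X v) \<le> w v" for v using card_mono[OF _ X(1)] by simp
      have cardI: "card I = (\<Sum>v\<in>V. card (X v))"
      proof -
        have "I = (SIGMA v:V. X v)" using I(1) by (auto simp: X_def W_def)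
        then show ?thesis using V X(2) by simp
      qed
      have disj: "card (X v) + card (f u v ` (X u \<times> {..<d})) \<le> w v" if uv: "{u, v} \<in> E" for u v
      proof -
        have "X v \<inter> f u v ` (X u \<times> {..<d}) = {}"
        proof (rule ccontr)
          assume "\<not> ?thesis"
          then obtain x i where xi: "(u, x) \<in> I" "i < d" "(v, f u v (x, i)) \<in> I" by (auto simp: X_def)
          then have "{(u, x), (v, f u v (x, i))} \<notin> R"
            using I(4) edge(3)[OF uv] by (auto simp: clique_def)
          moreover have "x < w u" using xi I(1) by (auto simp: W_def)
          ultimately show False using uv xi(2) by (auto simp: R_def)
        qed
        then have "card (X v) + card (f u v ` (X u \<times> {..<d})) = card (X v \<union> f u v ` (X u \<times> {..<d}))"
          using X(2) by (subst card_Un_disjoint) auto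
        also have "\<dots> \<le> card {..<w v}"
          using X(1)[of v] X(1)[of u] f[OF edge(1,2)[OF uv]] by (intro card_mono) auto
        finally show ?thesis by simp
      qed
      \<comment> \<open>The inequality is strict because the neighbours of a large set may miss
        \<open>p\<close> vertices of the next class: only more than \<open>p\<close> vertices there
        force a red edge.\<close>
      define S where "S = {v \<in> V. p < card (X v)}"
      have S_ind: "\<not> e \<subseteq> S" if "e \<in> E" for e
      proof
        assume "e \<subseteq> S"
        from that E obtain u v where e: "e = {u, v}" by (auto simp: nsets_def card_2_iff)
        then have "p < card (X u)" "p < card (X v)" using \<open>e \<subseteq> S\<close> by (auto simp: S_def)
        moreover have "{u, v} \<in> E" using e that by simp
        ultimately show False
          using disj[of u v] f_large[OF edge(1,2)[of u v] X(1)[of u]] by fastforce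
      qed
      define \<J> where "\<J> = {J. S \<subseteq> J \<and> J \<subseteq> V \<and> (\<forall>e\<in>E. \<not> e \<subseteq> J)}"
      have "finite \<J>" using V by (auto simp: \<J>_def intro: finite_subset[of _ "Pow V"])
      moreover have "S \<in> \<J>" using S_ind by (auto simp: \<J>_def S_def)
      ultimately obtain J where J: "J \<in> \<J>" "\<And>J'. J' \<in> \<J> \<Longrightarrow> J \<subseteq> J' \<Longrightarrow> J' = J"
        using finite_has_maximal[of \<J>] by (metis empty_iff)
      have J': "S \<subseteq> J" "J \<subseteq> V" "\<forall>e\<in>E. \<not> e \<subseteq> J" and finJ: "finite J"
        using J(1) V finite_subset by (auto simp: \<J>_def)
      have "\<exists>v\<in>J. {u, v} \<in> E" if u: "u \<in> V - J" for u
      proof -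
        have "insert u J \<notin> \<J>" using J(2)[of "insert u J"] u by blast
        then obtain e where e: "e \<in> E" "e \<subseteq> insert u J"
          using J' u by (auto simp: \<J>_def)
        then have "u \<in> e" using J'(3) by blast
        moreover from e(1) E obtain x y where "e = {x, y}" "x \<noteq> y" by (auto simp: nsets_def card_2_iff)
        ultimately obtain v where "e = {u, v}" "v \<noteq> u" by (metis doubleton_eq_iff insertE singletonD)
        then show ?thesis using e by auto
      qed
      then obtain g where g: "\<And>u. u \<in> V - J \<Longrightarrow> g u \<in> J \<and> {u, g u} \<in> E" by metis
      have absorb: "card (X v) + (\<Sum>u\<in>{u \<in> V - J. g u = v}. card (X u)) \<le> w v" if "v \<in> J" for v
      proof -
        define U where "U = {u \<in> V - J. g u = v}"
        have U: "finite U" "card U \<le> D"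
          using V card_mono[of V U] by (auto simp: U_def)
        have "D * card (X u) \<le> w v - card (X v)" if "u \<in> U" for u
        proof -
          have u: "u \<in> V" "v \<in> V" "{u, v} \<in> E" "card (X u) \<le> p"
            using that g J' by (auto simp: U_def S_def)
          show ?thesis using f_small[OF u(1,2) X(1) u(4)] disj[OF u(3)] by simp
        qed
        \<comment> \<open>Each of the at most \<open>D\<close> classes in \<open>U\<close> uses at
          most a \<open>1 / D\<close> share of the free space in class \<open>v\<close>, so together
          they fit into it. This is why the expansion factor bounds the number of classes.\<close>
        then have "(\<Sum>u\<in>U. D * card (X u)) \<le> card U * (w v - card (X v))"
          using sum_bounded_above[of U "\<lambda>u. D * card (X u)"] by simp
        also have "\<dots> \<le> D * (w v - card (X v))" using U by simp
        finally have "D * (\<Sum>u\<in>U. card (X u)) \<le> D * (w v - card (X v))"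
          by (simp add: sum_distrib_left)
        moreover have "D > 0" using V that J' by (metis card_gt_0_iff empty_iff gr_zeroI le_zero_eq subsetD)
        ultimately have "(\<Sum>u\<in>U. card (X u)) \<le> w v - card (X v)" by simp
        then show ?thesis using Xw[of v] by (simp add: U_def)
      qed
      have "card I = (\<Sum>v\<in>J. card (X v)) + (\<Sum>u\<in>V - J. card (X u))"
        unfolding cardI using V J' by (metis add.commute sum.subset_diff)
      also have "(\<Sum>u\<in>V - J. card (X u)) = (\<Sum>v\<in>J. \<Sum>u\<in>{u \<in> V - J. g u = v}. card (X u))"
        using V finJ g by (intro sum.group[symmetric]) auto
      also have "(\<Sum>v\<in>J. card (X v)) + \<dots> =
          (\<Sum>v\<in>J. card (X v) + (\<Sum>u\<in>{u \<in> V - J. g u = v}. card (X u)))"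
        by (simp add: sum.distrib)
      also have "\<dots> \<le> sum w J" by (rule sum_mono) (rule absorb)
      also have "\<dots> \<le> t" using ind J' by blast
      finally show False using I(3) by simp
    qed
    ultimately show "\<exists>R\<subseteq>blowup_edges E w. card R \<le> D * d * sum w V \<and>
        clique_free (t + 1) (SIGMA v:V. {..<w v}) ([SIGMA v:V. {..<w v}]\<^bsup>2\<^esup> - R)"
      unfolding W_def by blast
  qed
qed

section \<open>From a sparse red graph to a colouring of the complete graph\<close>

lemma clique_free_image:
  assumes "inj_on \<phi> W" "clique_free s W E" "\<Union>E \<subseteq> W"
  shows "clique_free s (\<phi> ` W) ((`) \<phi> ` E)"
  unfolding clique_free_def
proof (rule notI, elim exE conjE)
  fix K assume K: "K \<subseteq> \<phi> ` W" "finite K" "card K = s" "clique K ((`) \<phi> ` E)"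
  then obtain K' where K': "K' \<subseteq> W" "K = \<phi> ` K'" by (meson subset_imageE)
  have inj: "inj_on \<phi> K'" using assms(1) K'(1) inj_on_subset by blast
  have "{v, w} \<in> E" if vw: "v \<in> K'" "w \<in> K'" "v \<noteq> w" for v w
  proof -
    have "\<phi> v \<noteq> \<phi> w" using inj vw by (auto dest: inj_onD)
    then have "\<phi> ` {v, w} \<in> (`) \<phi> ` E" using K(4) K' vw by (auto simp: clique_def)
    then obtain e where e: "e \<in> E" "\<phi> ` {v, w} = \<phi> ` e" by blast
    then have "{v, w} = e"
      using inj_on_image_eq_iff[OF assms(1), of "{v, w}" e] K' vw assms(3) by blast
    then show ?thesis using e by simp
  qed
  moreover have "finite K'" "card K' = s"
    using K K' inj by (auto simp: card_image finite_image_iff)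
  ultimately show False using assms(2) K' by (auto simp: clique_free_def clique_def)
qed

text \<open>Colour \<open>R\<close> red, \<open>E - R\<close> purple and all other pairs blue. Then
  red and purple together form \<open>E\<close>, while blue and purple together form the complement
  of \<open>R\<close>; a bijection carries this colouring to \<open>{..<n}\<close>.\<close>

lemma max_purple_ge:
  fixes E R :: "'a set set"
  assumes W: "finite W" "card W = n" and E: "E \<subseteq> [W]\<^bsup>2\<^esup>" and R: "R \<subseteq> E"
    and s: "clique_free s W E" and t: "clique_free t W ([W]\<^bsup>2\<^esup> - R)"
  shows "card E \<le> max_purple n s t + card R"
proof -
  obtain \<phi> where "bij_betw \<phi> W {..<n}"
    using W by (metis bij_betw_iff_card card_lessThan finite_lessThan)
  then have inj: "inj_on \<phi> W" and img: "\<phi> ` W = {..<n}" by (auto simp: bij_betw_def)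
  have inj2: "inj_on ((`) \<phi>) (Pow W)" by (rule inj_on_image_Pow[OF inj])
  have sub: "[W]\<^bsup>2\<^esup> \<subseteq> Pow W" by (auto simp: nsets_def)
  let ?F = "(`) ((`) \<phi>)"
  have all: "?F ([W]\<^bsup>2\<^esup>) = [{..<n}]\<^bsup>2\<^esup>"
    using \<open>bij_betw \<phi> W {..<n}\<close> by (metis bij_betw_def bij_betw_nsets)
  have diff: "?F (A - B) = ?F A - ?F B" if "A \<subseteq> [W]\<^bsup>2\<^esup>" "B \<subseteq> [W]\<^bsup>2\<^esup>" for A B
    using that sub by (intro inj_on_image_set_diff[OF inj2]) auto
  have RW: "R \<subseteq> [W]\<^bsup>2\<^esup>" and fin: "finite E" "finite R"
    using E R W finite_subset[OF _ finite_imp_finite_nsets[OF W(1), of 2]] by auto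
  define P where "P = ?F (E - R)"
  have "rbp_colouring n (?F R) (?F ([W]\<^bsup>2\<^esup> - E)) P"
  proof -
    have "R \<union> ([W]\<^bsup>2\<^esup> - E) \<union> (E - R) = [W]\<^bsup>2\<^esup>" using E R by blast
    then have "?F R \<union> ?F ([W]\<^bsup>2\<^esup> - E) \<union> P = [{..<n}]\<^bsup>2\<^esup>"
      unfolding P_def image_Un [symmetric] all [symmetric] by simp
    moreover have "?F R \<subseteq> ?F E" using R by blast
    ultimately show ?thesis
      unfolding rbp_colouring_def P_def diff[OF E RW] diff[OF order.refl E] by auto
  qed
  moreover have "clique_free s {..<n} (?F R \<union> P)"
  proof -
    have "?F R \<union> P = ?F E" using R unfolding P_def by blast
    moreover have "\<Union>E \<subseteq> W" using E by (auto simp: nsets_def)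
    ultimately show ?thesis using clique_free_image[OF inj s] img by simp
  qed
  moreover have "clique_free t {..<n} (?F ([W]\<^bsup>2\<^esup> - E) \<union> P)"
  proof -
    have "([W]\<^bsup>2\<^esup> - E) \<union> (E - R) = [W]\<^bsup>2\<^esup> - R" using E R by blast
    then have "?F ([W]\<^bsup>2\<^esup> - E) \<union> P = ?F ([W]\<^bsup>2\<^esup> - R)" unfolding P_def image_Un [symmetric] by simp
    moreover have "\<Union>([W]\<^bsup>2\<^esup> - R) \<subseteq> W" by (auto simp: nsets_def)
    ultimately show ?thesis using clique_free_image[OF inj t] img by simp
  qed
  ultimately have "card P \<in> {card P | R B P. rbp_colouring n R B P \<and>
     clique_free s {..<n} (R \<union> P) \<and> clique_free t {..<n} (B \<union> P)}" by blast
  \<comment> \<open>Finiteness of the set of values makes \<open>Max\<close> an upper bound for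
    them.\<close>
  moreover have "finite {card P | R B P. rbp_colouring n R B P \<and>
     clique_free s {..<n} (R \<union> P) \<and> clique_free t {..<n} (B \<union> P)}"
  proof (rule finite_subset)
    show "{card P | R B P. rbp_colouring n R B P \<and>
     clique_free s {..<n} (R \<union> P) \<and> clique_free t {..<n} (B \<union> P)} \<subseteq> card ` Pow ([{..<n}]\<^bsup>2\<^esup>)"
      by (auto simp: rbp_colouring_def)
  qed (simp add: finite_imp_finite_nsets)
  ultimately have "card P \<le> max_purple n s t" unfolding max_purple_def by (rule Max_ge[rotated])
  moreover have "card P = card (E - R)"
    unfolding P_def using inj2 by (rule card_image[OF inj_on_subset]) (use E sub in auto)
  moreover have "card (E - R) = card E - card R" using fin R by (simp add: card_Diff_subset)
  ultimately show ?thesis by simp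
qed

section \<open>Edges and cliques of blow-ups\<close>

lemma blowup_edges_iff:
  "{(u, x), (v, y)} \<in> blowup_edges E w \<longleftrightarrow> {u, v} \<in> E \<and> x < w u \<and> y < w v"
  by (auto simp: blowup_edges_def doubleton_eq_iff insert_commute)

lemma blowup_edges_subset:
  assumes "E \<subseteq> [V]\<^bsup>2\<^esup>"
  shows "blowup_edges E w \<subseteq> [SIGMA v:V. {..<w v}]\<^bsup>2\<^esup>"
proof
  fix e assume "e \<in> blowup_edges E w"
  then obtain u v x y where e: "e = {(u, x), (v, y)}" "{u, v} \<in> E" "x < w u" "y < w v"
    by (auto simp: blowup_edges_def)
  moreover have "u \<in> V" "v \<in> V" "u \<noteq> v"
    using e(2) assms by (auto simp: nsets_def card_insert_if split: if_splits)
  ultimately show "e \<in> [SIGMA v:V. {..<w v}]\<^bsup>2\<^esup>" by (auto simp: nsets_def)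
qed

text \<open>As \<open>E\<close> has no loops, a clique meets each class at most once, so the
  projection to \<open>V\<close> is injective on it and yields a clique of the same size.\<close>

lemma clique_free_blowup:
  assumes E: "E \<subseteq> [V]\<^bsup>2\<^esup>" and "clique_free s V E"
  shows "clique_free s (SIGMA v:V. {..<w v}) (blowup_edges E w)"
  unfolding clique_free_def
proof (rule notI, elim exE conjE)
  fix K assume K: "K \<subseteq> (SIGMA v:V. {..<w v})" "finite K" "card K = s" "clique K (blowup_edges E w)"
  have adj: "{fst z, fst z'} \<in> E" if "z \<in> K" "z' \<in> K" "z \<noteq> z'" for z z'
    using K(4) that blowup_edges_iff[of "fst z" "snd z" "fst z'" "snd z'"]
    by (auto simp: clique_def)
  have "inj_on fst K"
  proof (rule inj_onI, rule ccontr)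
    fix z z' assume "z \<in> K" "z' \<in> K" "fst z = fst z'" "z \<noteq> z'"
    then have "{fst z} \<in> E" using adj by fastforce
    then show False using E by (auto simp: nsets_def)
  qed
  then have "card (fst ` K) = s" using K(3) by (simp add: card_image)
  moreover have "fst ` K \<subseteq> V" using K(1) by auto
  moreover have "clique (fst ` K) E" using adj by (auto simp: clique_def)
  ultimately show False using assms(2) K(2) by (auto simp: clique_free_def)
qed

section \<open>Andrasfai graphs and their canonical blow-ups\<close>

text \<open>The interval from \<open>k\<close> to \<open>2 * k - 1\<close> is symmetric under
  negation modulo \<open>3 * k - 1\<close>, so adjacency depends only on the absolute difference of
  representatives. This removes \<open>mod\<close> and leaves linear arithmetic.\<close>

lemma andrasfai_edges_iff:
  "{i, j} \<in> andrasfai_edges k \<longleftrightarrow> i \<in> andrasfai_verts k \<and> j \<in> andrasfai_verts k \<and>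
     int k \<le> \<bar>i - j\<bar> \<and> \<bar>i - j\<bar> \<le> 2 * int k - 1"
proof -
  define m where "m = 3 * int k - 1"
  have *: "(i - j) mod m \<in> {int k..2 * int k - 1} \<longleftrightarrow> int k \<le> \<bar>i - j\<bar> \<and> \<bar>i - j\<bar> \<le> 2 * int k - 1"
    if "i \<in> andrasfai_verts k" "j \<in> andrasfai_verts k" for i j
  proof (cases "j \<le> i")
    case True
    then have "(i - j) mod m = i - j"
      using that by (intro mod_pos_pos_trivial) (auto simp: andrasfai_verts_def m_def)
    then show ?thesis using True by auto
  next
    case False
    have "(i - j) mod m = (i - j + m) mod m" by simp
    also have "\<dots> = i - j + m"
      using that False by (intro mod_pos_pos_trivial) (auto simp: andrasfai_verts_def m_def)
    finally show ?thesis using False by (auto simp: m_def)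
  qed
  have "{i, j} \<in> andrasfai_edges k \<longleftrightarrow> i \<in> andrasfai_verts k \<and> j \<in> andrasfai_verts k \<and>
     ((i - j) mod m \<in> {int k..2 * int k - 1} \<or> (j - i) mod m \<in> {int k..2 * int k - 1})"
    unfolding andrasfai_edges_def m_def [symmetric] by (auto simp: doubleton_eq_iff)
  then show ?thesis using *[of i j] *[of j i] by (auto simp: abs_minus_commute)
qed

lemma andrasfai_edges_subset:
  assumes "k \<ge> 1"
  shows "andrasfai_edges k \<subseteq> [andrasfai_verts k]\<^bsup>2\<^esup>"
proof
  fix e assume e: "e \<in> andrasfai_edges k"
  then obtain i j where ij: "e = {i, j}" by (auto simp: andrasfai_edges_def)
  with e assms show "e \<in> [andrasfai_verts k]\<^bsup>2\<^esup>"
    by (auto simp: andrasfai_edges_iff nsets_def card_insert_if)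
qed

text \<open>For three vertices in increasing order, the two inner distances are at least
  \<open>k\<close> each, so the outer one is at least \<open>2 * k\<close>, one more than an edge
  allows.\<close>

lemma andrasfai_triangle_free:
  assumes "k \<ge> 1"
  shows "clique_free 3 (andrasfai_verts k) (andrasfai_edges k)"
  unfolding clique_free_def
proof (rule notI, elim exE conjE)
  fix K assume K: "card K = 3" "clique K (andrasfai_edges k)"
  then obtain x y z where "K = {x, y, z}" "x \<noteq> y" "y \<noteq> z" "x \<noteq> z"
    by (auto simp: card_3_iff)
  then have "{x, y} \<in> andrasfai_edges k" "{y, z} \<in> andrasfai_edges k" "{x, z} \<in> andrasfai_edges k"
    using K(2) by (auto simp: clique_def)
  then show False using assms unfolding andrasfai_edges_iff by linarith
qed

text \<open>An independent set lies in a cyclic interval of length \<open>k\<close>, and every such interval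
  contains one of the vertices \<open>1\<close>, \<open>k\<close>, \<open>2 k\<close>.\<close>

lemma andrasfai_independent_cover:
  assumes k: "k \<ge> 2" and S: "S \<subseteq> andrasfai_verts k" "\<forall>e\<in>andrasfai_edges k. \<not> e \<subseteq> S"
  obtains J where "S \<subseteq> J" "finite J" "card J \<le> k" "card J < k \<or> J \<inter> {1, int k, 2 * int k} \<noteq> {}"
proof (cases "S = {}")
  case True
  then show ?thesis using k by (intro that[of "{}"]) auto
next
  case False
  have fin: "finite S" using S(1) by (rule finite_subset) (simp add: andrasfai_verts_def)
  have rng: "0 \<le> i \<and> i \<le> 3 * int k - 2" if "i \<in> S" for i
    using S(1) that by (auto simp: andrasfai_verts_def)
  have far: "\<bar>i - j\<bar> < int k \<or> 2 * int k \<le> \<bar>i - j\<bar>" if "i \<in> S" "j \<in> S" for i j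
  proof -
    have "{i, j} \<notin> andrasfai_edges k" using bspec[OF S(2), of "{i, j}"] that by auto
    moreover have "i \<in> andrasfai_verts k" "j \<in> andrasfai_verts k" using S(1) that by auto
    ultimately show ?thesis unfolding andrasfai_edges_iff by linarith
  qed
  define x where "x = Min S"
  have x: "x \<in> S" "\<And>i. i \<in> S \<Longrightarrow> x \<le> i" using False fin by (auto simp: x_def)
  define T where "T = {i \<in> S. x + 2 * int k \<le> i}"
  show ?thesis
  proof (cases "T = {}")
    case True
    \<comment> \<open>No element of \<open>S\<close> is far enough from its minimum \<open>x\<close>
      to wrap around. The interval is cut at the last vertex; for \<open>x\<close> above
      \<open>2 * k\<close> this leaves fewer than \<open>k\<close> elements.\<close>
    define J where "J = {x..min (x + int k - 1) (3 * int k - 2)}"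
    have "S \<subseteq> J"
    proof
      fix i assume i: "i \<in> S"
      then have "i < x + 2 * int k" using True by (auto simp: T_def not_le)
      then show "i \<in> J" using far[OF i x(1)] x(2)[OF i] rng[OF i] by (auto simp: J_def)
    qed
    moreover have "finite J" "card J \<le> k" by (auto simp: J_def)
    moreover have "card J < k \<or> J \<inter> {1, int k, 2 * int k} \<noteq> {}"
    proof -
      consider "x \<le> 1" | "1 < x" "x \<le> int k" | "int k < x" "x \<le> 2 * int k" | "2 * int k < x"
        by linarith
      then show ?thesis
        using k rng[OF x(1)] by cases (auto simp: J_def)
    qed
    ultimately show ?thesis by (rule that)
  next
    case False
    define y where "y = Min T"
    have "finite T" using fin by (simp add: T_def)
    then have y: "y \<in> T" "\<And>i. i \<in> T \<Longrightarrow> y \<le> i" using False by (auto simp: y_def)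
    have yS: "y \<in> S" "x + 2 * int k \<le> y" using y(1) by (auto simp: T_def)
    \<comment> \<open>The cyclic interval of length \<open>k\<close> that starts at \<open>y\<close>
      and wraps past \<open>0\<close>: its last element \<open>y + k - 1\<close> is
      \<open>y - 2 * k\<close> modulo \<open>3 * k - 1\<close>.\<close>
    define J where "J = {0..y - 2 * int k} \<union> {y..3 * int k - 2}"
    have "S \<subseteq> J"
    proof
      fix i assume i: "i \<in> S"
      show "i \<in> J"
      proof (cases "i \<in> T")
        case True
        then show ?thesis using y(2) rng[OF i] by (auto simp: J_def)
      next
        case False
        then have "i < x + 2 * int k" using i by (auto simp: T_def)
        then have "i < x + int k" using far[OF i x(1)] x(2)[OF i] by linarith
        then have "i \<le> y - 2 * int k" using far[OF i yS(1)] yS(2) by linarith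
        then show ?thesis using rng[OF i] by (simp add: J_def)
      qed
    qed
    moreover have "finite J" by (simp add: J_def)
    moreover have "card J \<le> k"
    proof -
      have "card J \<le> card {0..y - 2 * int k} + card {y..3 * int k - 2}"
        unfolding J_def by (rule card_Un_le)
      also have "\<dots> \<le> k" using rng[OF yS(1)] rng[OF x(1)] yS(2) by simp
      finally show ?thesis .
    qed
    moreover have "J \<inter> {1, int k, 2 * int k} \<noteq> {}"
    proof (cases "y = 2 * int k")
      case True
      then show ?thesis using k by (auto simp: J_def)
    next
      case False
      then have "1 \<in> J" using rng[OF x(1)] yS(2) by (auto simp: J_def)
      then show ?thesis by blast
    qed
    ultimately show ?thesis using that by blast
  qed
qed

section \<open>Class sizes of the canonical blow-up\<close>

text \<open>The lower bound on \<open>t\<close> is equivalent to \<open>a \<le> b\<close>, and the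
  upper bound says that \<open>a\<close> is positive before truncation. The two sums are the weight
  of \<open>k\<close> classes of which exactly one is light, and the total weight.\<close>

lemma canonical_weights:
  assumes "canonical_index n t k"
  obtains a b where "canonical_weight n k t = (\<lambda>v. if v \<in> {1, int k, 2 * int k} then a else b)"
    "int a = (int k - 1) * int n - (3 * int k - 4) * int t" "int b = 3 * int t - int n"
    "a \<le> b" "a + (k - 1) * b = t" "3 * a + (3 * k - 4) * b = n"
proof -
  have k: "k \<ge> 2" and lo: "real k * real n / (3 * real k - 1) \<le> real t"
    and hi: "real t < (real k - 1) * real n / (3 * real k - 4)"
    using assms by (auto simp: canonical_index_def)
  have "real k * real n \<le> real t * (3 * real k - 1)"
    using lo k by (simp add: pos_divide_le_eq)
  then have "real_of_int (int k * int n) \<le> real_of_int (int t * (3 * int k - 1))" by simp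
  then have lo': "int k * int n \<le> int t * (3 * int k - 1)" by (simp only: of_int_le_iff)
  have "real t * (3 * real k - 4) < (real k - 1) * real n"
    using hi k by (simp add: pos_less_divide_eq)
  then have "real_of_int (int t * (3 * int k - 4)) < real_of_int ((int k - 1) * int n)" by simp
  then have hi': "int t * (3 * int k - 4) < (int k - 1) * int n" by (simp only: of_int_less_iff)
  define a where "a = nat ((int k - 1) * int n - (3 * int k - 4) * int t)"
  define b where "b = nat (3 * int t - int n)"
  have a: "int a = (int k - 1) * int n - (3 * int k - 4) * int t"
    using hi' by (simp add: a_def mult.commute)
  have "int a \<le> 3 * int t - int n" using lo' by (simp add: a algebra_simps)
  then have b: "int b = 3 * int t - int n" by (simp add: b_def)
  have "a \<le> b" using \<open>int a \<le> _\<close> b by linarith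
  have "int (a + (k - 1) * b) = int a + (int k - 1) * int b" using k by (simp add: of_nat_diff)
  also have "\<dots> = int t" by (simp add: a b algebra_simps)
  finally have t: "a + (k - 1) * b = t" by (simp only: of_nat_eq_iff)
  have "int (3 * a + (3 * k - 4) * b) = 3 * int a + (3 * int k - 4) * int b"
    using k by (simp add: of_nat_diff)
  also have "\<dots> = int n" by (simp add: a b algebra_simps)
  finally have n: "3 * a + (3 * k - 4) * b = n" by (simp only: of_nat_eq_iff)
  have "canonical_weight n k t = (\<lambda>v. if v \<in> {1, int k, 2 * int k} then a else b)"
    by (simp add: canonical_weight_def a_def b_def fun_eq_iff)
  then show ?thesis using a b \<open>a \<le> b\<close> t n by (rule that)
qed

lemma sum_canonical_weight:
  assumes "canonical_index n t k"
  shows "sum (canonical_weight n k t) (andrasfai_verts k) = n"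
proof -
  have k: "k \<ge> 2" using assms by (simp add: canonical_index_def)
  obtain a b where w: "canonical_weight n k t = (\<lambda>v. if v \<in> {1, int k, 2 * int k} then a else b)"
    and n: "3 * a + (3 * k - 4) * b = n"
    using canonical_weights[OF assms] by metis
  let ?Q = "{1, int k, 2 * int k}"
  have Q: "?Q \<subseteq> andrasfai_verts k" "card ?Q = 3" using k by (auto simp: andrasfai_verts_def)
  have "sum (canonical_weight n k t) (andrasfai_verts k) =
      sum (canonical_weight n k t) (andrasfai_verts k - ?Q) + sum (canonical_weight n k t) ?Q"
    by (rule sum.subset_diff[OF Q(1)]) (simp add: andrasfai_verts_def)
  also have "sum (canonical_weight n k t) (andrasfai_verts k - ?Q) = (\<Sum>v\<in>andrasfai_verts k - ?Q. b)"
    by (rule sum.cong) (auto simp: w)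
  also have "\<dots> = (3 * k - 4) * b"
  proof -
    have "card (andrasfai_verts k - ?Q) = 3 * k - 4"
      using card_Diff_subset[OF _ Q(1)] Q(2) by (simp add: andrasfai_verts_def)
    then show ?thesis by simp
  qed
  also have "sum (canonical_weight n k t) ?Q = (\<Sum>v\<in>?Q. a)" by (rule sum.cong) (auto simp: w)
  also have "\<dots> = 3 * a" using Q(2) by simp
  finally show ?thesis using n by simp
qed

text \<open>An independent set is covered by fewer than \<open>k\<close> classes, or by
  \<open>k\<close> classes at least one of which is light; as \<open>a \<le> b\<close>, either way
  the weight is at most \<open>a + (k - 1) * b\<close>.\<close>

lemma canonical_weight_independent:
  assumes "canonical_index n t k"
    and S: "S \<subseteq> andrasfai_verts k" "\<forall>e\<in>andrasfai_edges k. \<not> e \<subseteq> S"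
  shows "sum (canonical_weight n k t) S \<le> t"
proof -
  let ?w = "canonical_weight n k t"
  have k: "k \<ge> 2" using assms by (simp add: canonical_index_def)
  obtain a b where w: "?w = (\<lambda>v. if v \<in> {1, int k, 2 * int k} then a else b)"
    and ab: "a \<le> b" and t: "a + (k - 1) * b = t"
    using canonical_weights[OF assms(1)] by metis
  have le: "?w v \<le> b" for v using ab by (simp add: w)
  have bound: "sum ?w X \<le> (k - 1) * b" if "card X < k" for X
  proof -
    have "sum ?w X \<le> card X * b" using sum_bounded_above[of X ?w b] le by simp
    also have "\<dots> \<le> (k - 1) * b" using that by (intro mult_le_mono1) simp
    finally show ?thesis .
  qed
  obtain J where J: "S \<subseteq> J" "finite J" "card J \<le> k"
    "card J < k \<or> J \<inter> {1, int k, 2 * int k} \<noteq> {}"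
    using andrasfai_independent_cover[OF k S] by blast
  have "sum ?w S \<le> sum ?w J" using J by (intro sum_mono2) auto
  also have "\<dots> \<le> t"
    using J(4)
  proof
    assume "card J < k"
    then show ?thesis using bound[of J] t by simp
  next
    assume "J \<inter> {1, int k, 2 * int k} \<noteq> {}"
    then obtain v where v: "v \<in> J" "v \<in> {1, int k, 2 * int k}" by blast
    have "sum ?w J = ?w v + sum ?w (J - {v})" using J(2) v(1) by (rule sum.remove)
    also have "?w v = a" using v(2) by (simp add: w)
    also have "sum ?w (J - {v}) \<le> (k - 1) * b"
      using J v k by (intro bound) (simp add: card_Diff_singleton)
    finally show ?thesis using t by simp
  qed
  finally show ?thesis .
qed

section \<open>Choice of the constants and conclusion\<close>

theorem theorem3p2:
  fixes c :: real
  assumes "1 / 3 < c" and "c < 1 / 2"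
  shows "\<exists>C::real. \<forall>n t k :: nat.
           n \<ge> 1 \<longrightarrow> int t = \<lceil>c * real n\<rceil> \<longrightarrow> canonical_index n t k \<longrightarrow>
           real (max_purple n 3 (t + 1)) \<ge> real (card (canonical_blowup_edges n k t)) - C * real n"
proof -
  \<comment> \<open>\<open>gap k\<close> is the limiting proportion of a light class,
    \<open>3 * c - 1\<close> that of a heavy one. Every index that occurs has
    \<open>gap k > 0\<close>, which forces \<open>k \<le> K\<close>; hence \<open>\<delta>\<close>
    bounds all relevant proportions from below.\<close>
  define K where "K = nat \<lceil>(4 * c - 1) / (3 * c - 1)\<rceil>"
  define gap where "gap = (\<lambda>k. (real k - 1) - (3 * real k - 4) * c)"
  define \<delta> where "\<delta> = Min (insert (3 * c - 1) (gap ` {k \<in> {..K}. 0 < gap k}))"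
  have \<delta>_pos: "\<delta> > 0" using assms by (auto simp: \<delta>_def)
  have \<delta>_le: "\<delta> \<le> 3 * c - 1" "\<And>k. k \<le> K \<Longrightarrow> 0 < gap k \<Longrightarrow> \<delta> \<le> gap k"
    unfolding \<delta>_def by (auto intro!: Min_le)
  define D where "D = 3 * K"
  \<comment> \<open>Below, \<open>p\<close> is \<open>\<delta> * n / (4 * D)\<close> rounded down,
    which loses at most a factor \<open>2\<close>; hence \<open>n \<le> L * p\<close>.\<close>
  define L where "L = nat \<lceil>8 * real D / \<delta>\<rceil>"
  have L: "8 * real D / \<delta> \<le> real L" unfolding L_def by (rule of_nat_ceiling)
  obtain d where d: "\<And>(V :: int set) E w p t. \<lbrakk>finite V; card V \<le> D; E \<subseteq> [V]\<^bsup>2\<^esup>; 0 < p;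
     \<And>v. v \<in> V \<Longrightarrow> 2 * D * p \<le> w v \<and> w v \<le> L * p;
     \<And>S. S \<subseteq> V \<Longrightarrow> (\<forall>e\<in>E. \<not> e \<subseteq> S) \<Longrightarrow> sum w S \<le> t\<rbrakk> \<Longrightarrow>
     \<exists>R\<subseteq>blowup_edges E w. card R \<le> d * sum w V \<and>
        clique_free (t + 1) (SIGMA v:V. {..<w v}) ([SIGMA v:V. {..<w v}]\<^bsup>2\<^esup> - R)"
    by (rule sparse_subgraph_of_blowup[of D L, where 'a = int]) blast
  have "card (canonical_blowup_edges n k t) \<le> max_purple n 3 (t + 1) + (d + L) * n"
    if n: "n \<ge> 1" and t: "int t = \<lceil>c * real n\<rceil>" and idx: "canonical_index n t k" for n t k
  proof -
    let ?V = "andrasfai_verts k" and ?E = "andrasfai_edges k" and ?w = "canonical_weight n k t"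
    define W where "W = (SIGMA v:?V. {..<?w v})"
    have k: "k \<ge> 2" using idx by (simp add: canonical_index_def)
    have E: "?E \<subseteq> [?V]\<^bsup>2\<^esup>" using k by (intro andrasfai_edges_subset) simp
    have V: "finite ?V" "card ?V = 3 * k - 1" by (auto simp: andrasfai_verts_def)
    have W: "finite W" "card W = n"
      using V sum_canonical_weight[OF idx] by (auto simp: W_def)
    have blow: "canonical_blowup_edges n k t \<subseteq> [W]\<^bsup>2\<^esup>"
      unfolding canonical_blowup_edges_def W_def by (rule blowup_edges_subset[OF E])
    show ?thesis
    proof (cases "n < L")
      case True
      \<comment> \<open>For \<open>n < L\<close> the number of all edges is already below
        \<open>L * n\<close>, which the summand \<open>L\<close> of the constant absorbs.\<close>
      have "card (canonical_blowup_edges n k t) \<le> card ([W]\<^bsup>2\<^esup>)"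
        using blow W(1) by (intro card_mono finite_imp_finite_nsets)
      also have "\<dots> = n choose 2" using W by (simp add: card_nsets)
      also have "\<dots> \<le> n * n" 
        unfolding choose_two by (rule order_trans[OF div_le_dividend]) simp
      also have "\<dots> \<le> (d + L) * n" using True by (intro mult_le_mono1) simp
      finally show ?thesis by simp
    next
      case False
      obtain a b where w: "?w = (\<lambda>v. if v \<in> {1, int k, 2 * int k} then a else b)"
        and a: "int a = (int k - 1) * int n - (3 * int k - 4) * int t"
        and b: "int b = 3 * int t - int n" and sum: "3 * a + (3 * k - 4) * b = n"
        using canonical_weights[OF idx] by metis
      have t_ge: "c * real n \<le> real t" and t_le: "real t \<le> c * real n + 1" using t by linarith+
      have n0: "real n > 0" using n by simp
      have hi: "real t * (3 * real k - 4) < (real k - 1) * real n"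
        using idx k by (simp add: canonical_index_def pos_less_divide_eq)
      have "(c * real n) * (3 * real k - 4) \<le> real t * (3 * real k - 4)"
        using t_ge k by (intro mult_right_mono) auto
      with hi have "0 < gap k * real n" by (simp add: gap_def algebra_simps)
      then have gap: "0 < gap k" using n0 by (simp add: zero_less_mult_iff)
      then have "real k * (3 * c - 1) < 4 * c - 1" by (simp add: gap_def algebra_simps)
      then have "real k < (4 * c - 1) / (3 * c - 1)" using assms by (simp add: pos_less_divide_eq)
      then have kK: "k \<le> K" unfolding K_def by linarith
      then have D0: "real D > 0" and cardV: "card ?V \<le> D" using k V by (auto simp: D_def)
      have "8 * real D / \<delta> \<le> real n" using L False by linarith
      then have big: "8 * real D \<le> \<delta> * real n" using \<delta>_pos by (simp add: pos_divide_le_eq mult.commute)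
      define q where "q = \<delta> * real n / (4 * real D)"
      have q: "2 \<le> q" using big D0 by (simp add: q_def pos_le_divide_eq)
      define p where "p = nat \<lfloor>q\<rfloor>"
      have p: "real p \<le> q" "q / 2 \<le> real p" "p > 0" using q by (auto simp: p_def) linarith+
      have "4 * real D * real p \<le> \<delta> * real n"
        using p(1) D0 by (simp add: q_def pos_le_divide_eq mult_ac)
      \<comment> \<open>The spare \<open>D\<close> pays for rounding \<open>t\<close> up, which
        lowers a light class by at most \<open>3 * k - 4\<close> vertices.\<close>
      then have Dp: "2 * real D * real p \<le> \<delta> * real n - real D" using big D0 by linarith
      have "real n = (8 * real D / \<delta>) * (q / 2)" using D0 \<delta>_pos by (simp add: q_def)
      also have "\<dots> \<le> real L * real p" using L p q by (intro mult_mono) auto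
      finally have "real n \<le> real (L * p)" by simp
      then have nL: "n \<le> L * p" by (simp only: of_nat_le_iff)
      have "2 * D * p \<le> a"
      proof -
        have "\<delta> * real n \<le> gap k * real n" using \<delta>_le(2)[OF kK gap] n0 by (intro mult_right_mono) auto
        moreover have "(3 * real k - 4) * real t \<le> (3 * real k - 4) * (c * real n + 1)"
          using t_le k by (intro mult_left_mono) auto
        moreover have "3 * real k - 4 \<le> real D" using kK by (simp add: D_def)
        ultimately have "\<delta> * real n - real D \<le> (real k - 1) * real n - (3 * real k - 4) * real t"
          by (simp add: gap_def algebra_simps)
        also have "\<dots> = real_of_int (int a)" unfolding a by simp
        finally have "real (2 * D * p) \<le> real a" using Dp by simp
        then show ?thesis by (simp only: of_nat_le_iff)
      qed
      moreover have "2 * D * p \<le> b"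
      proof -
        have "\<delta> * real n \<le> (3 * c - 1) * real n" using \<delta>_le(1) n0 by (intro mult_right_mono) auto
        also have "\<dots> \<le> 3 * real t - real n" using t_ge by (simp add: algebra_simps)
        also have "\<dots> = real_of_int (int b)" unfolding b by simp
        finally have "real (2 * D * p) \<le> real b" using Dp D0 by simp
        then show ?thesis by (simp only: of_nat_le_iff)
      qed
      moreover have "a \<le> n" "b \<le> n"
      proof -
        have "1 * b \<le> (3 * k - 4) * b" using k by (intro mult_le_mono1) simp
        then show "a \<le> n" "b \<le> n" using sum by linarith+
      qed
      ultimately have "2 * D * p \<le> ?w v \<and> ?w v \<le> L * p" for v using nL by (auto simp: w)
      then obtain R where R: "R \<subseteq> blowup_edges ?E ?w" "card R \<le> d * sum ?w ?V"
        "clique_free (t + 1) W ([W]\<^bsup>2\<^esup> - R)"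
        using d[OF V(1) cardV E p(3), of ?w t] canonical_weight_independent[OF idx]
        unfolding W_def by blast
      have "clique_free 3 W (canonical_blowup_edges n k t)"
        unfolding canonical_blowup_edges_def W_def
        using k by (intro clique_free_blowup[OF E] andrasfai_triangle_free) simp
      then have "card (canonical_blowup_edges n k t) \<le> max_purple n 3 (t + 1) + card R"
        using R(1,3) by (intro max_purple_ge[OF W blow]) (simp_all add: canonical_blowup_edges_def)
      also have "card R \<le> d * n" using R(2) sum_canonical_weight[OF idx] by simp
      finally show ?thesis by (simp add: algebra_simps)
    qed
  qed
  then have "real (card (canonical_blowup_edges n k t)) \<le>
      real (max_purple n 3 (t + 1)) + real (d + L) * real n"
    if "n \<ge> 1" "int t = \<lceil>c * real n\<rceil>" "canonical_index n t k" for n t k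
    using that by (metis of_nat_add of_nat_le_iff of_nat_mult)
  then show ?thesis
    by (intro exI[of _ "real (d + L)"] allI impI) (simp add: algebra_simps)
qed

end
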